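(* A complex $n\times n$ matrix $A$ satisfies Condition C2 if and only if every $n\times n$ matrix $B$ cubic similar to $A$ satisfies Condition C2.
   Context: For $u,v\in\mathbb{C}^n$, $u*v=(u_1v_1,\ldots,u_nv_n)$ is the coordinatewise product, $u^k$ is the coordinatewise $k$-th power, and $\Delta[u]$ is the diagonal $n\times n$ matrix with $(i,i)$ entry $u_i$. $\mathcal{M}_n$ is the set of complex $n\times n$ matrices. Define $$W_n=\{(y,z,A)\in\mathbb{C}^n\times\mathbb{C}^n\times\mathcal{M}_n:\ \det(Id+\Delta[(sz+tA.y)^2].A)=1\ \forall s,t\in\mathbb{C},\ z+A.(z^3+z*(A.y)^2)=0\}.$$ An $n\times n$ matrix $A$ satisfies Condition C2 (also called Condition 2) if whenever $(y,z,A)\in W_n$ then $z=0$. Two $n\times n$ matrices $A$ and $B$ are cubic similar if there is an invertible matrix $L$ such that $(Bx)^3=L^{-1}\big((ALx)^3\big)$ for all $x\in\mathbb{C}^n$ (cubes taken coordinatewise). *)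

theory Defs
  imports "HOL-Analysis.Analysis"
begin

text \<open>
  On vectors \<open>complex ^ 'n\<close> the library operations \<open>u * v\<close> and \<open>u ^ k\<close> are coordinatewise, so they
  are the product and power intended here. On matrices they would be entrywise as well and are
  never used; the matrix product is \<open>**\<close>.
\<close>

definition diag_mat :: "complex ^ 'n \<Rightarrow> complex ^ 'n ^ 'n" where
  "diag_mat u = (\<chi> i j. if i = j then u $ i else 0)"

definition W :: "((complex ^ 'n) \<times> (complex ^ 'n) \<times> (complex ^ 'n ^ 'n)) set" where
  "W = {(y, z, A).
          (\<forall>s t :: complex. det (mat 1 + diag_mat ((s *s z + t *s (A *v y)) ^ 2) ** A) = 1) \<and>
          z + A *v (z ^ 3 + z * (A *v y) ^ 2) = 0}"

definition condition_C2 :: "complex ^ 'n ^ 'n \<Rightarrow> bool" where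
  "condition_C2 A \<longleftrightarrow> (\<forall>y z. (y, z, A) \<in> W \<longrightarrow> z = 0)"

definition cubic_similar :: "complex ^ 'n ^ 'n \<Rightarrow> complex ^ 'n ^ 'n \<Rightarrow> bool" where
  "cubic_similar A B \<longleftrightarrow>
     (\<exists>L :: complex ^ 'n ^ 'n. invertible L \<and>
        (\<forall>x. (B *v x) ^ 3 = matrix_inv L *v ((A *v (L *v x)) ^ 3)))"

end

theory Submission
  imports Defs
begin

text \<open>
  If \<open>z + A(z\<^sup>3 + z * (Ay)\<^sup>2) = 0\<close> then \<open>z = Aw\<close> for \<open>w = -(z\<^sup>3 + z * (Ay)\<^sup>2)\<close>, and
  \<open>w = -((Aw)\<^sup>3 + (Aw) * (Ay)\<^sup>2)\<close>, so that \<open>z = 0\<close> iff \<open>w = 0\<close>. In the variables \<open>y, w\<close> the conditions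
  defining \<open>W\<close> involve \<open>A\<close> only through the cubic map \<open>x \<mapsto> (Ax)\<^sup>3\<close> and its Jacobian
  \<open>3 \<Delta>[(Ax)\<^sup>2] A\<close>, and polarization makes a cubic similarity conjugate both of them by \<open>L\<close>.
  Hence \<open>(y, w) \<mapsto> (Ly, Lw)\<close> carries the solutions for \<open>B\<close> to solutions for \<open>A\<close>.
\<close>

lemma diag_mat_mult_vec: "diag_mat u *v x = u * x"
  by (simp add: diag_mat_def matrix_vector_mult_def vec_eq_iff if_distrib if_distribR cong: if_cong)

text \<open>The terms in \<open>u ^ 3\<close> and \<open>u * v ^ 2\<close> cancel, so
  \<open>u ^ 2 * v\<close> is a linear combination of cubes.\<close>

lemma cube_polarization:
  fixes u v :: "complex ^ 'n"
  shows "(u + v) ^ 3 + (v - u) ^ 3 - 2 *s v ^ 3 = 6 *s (u ^ 2 * v)"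
  by (simp add: vec_eq_iff power3_eq_cube power2_eq_square algebra_simps)

lemma det_conjugate:
  fixes A L M :: "'a::comm_ring_1 ^ 'n ^ 'n"
  assumes "M ** L = mat 1"
  shows "det (M ** A ** L) = det A"
proof -
  have "det M * det L = 1"
    using assms by (metis det_I det_mul)
  then show ?thesis
    by (simp add: det_mul mult_ac)
qed

lemma matrix_vector_mult_uminus: "A *v (- x) = - (A *v x :: 'a::ring_1 ^ 'm)"
  by (simp add: matrix_vector_mult_def vec_eq_iff sum_negf)

lemma matrix_inv_inverse:
  fixes L :: "'a::semiring_1 ^ 'n ^ 'm"
  assumes "invertible L"
  shows "L ** matrix_inv L = mat 1" and "matrix_inv L ** L = mat 1"
  using someI_ex[OF assms[unfolded invertible_def]] by (simp_all add: matrix_inv_def)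

lemma cubic_similar_refl:
  fixes A :: "complex ^ 'n ^ 'n"
  shows "cubic_similar A A"
proof -
  have inv1: "invertible (mat 1 :: complex ^ 'n ^ 'n)"
    unfolding invertible_def by (intro exI[of _ "mat 1"]) simp
  have "matrix_inv (mat 1 :: complex ^ 'n ^ 'n) = mat 1"
    using matrix_inv_inverse(2)[OF inv1] by simp
  with inv1 show ?thesis
    unfolding cubic_similar_def by (intro exI[of _ "mat 1"]) simp
qed

text \<open>Polarization stands in for differentiating \<open>sim\<close>: the hypothesis is used at
  \<open>x + w\<close>, \<open>w - x\<close> and \<open>w\<close>, and \<open>M\<close> passes
  through the combination by linearity.\<close>

lemma cubic_conjugacy_polarized:
  fixes A B L M :: "complex ^ 'n ^ 'n"
  assumes sim: "\<And>x. (B *v x) ^ 3 = M *v ((A *v (L *v x)) ^ 3)"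
  shows "(B *v x) ^ 2 * (B *v w) = M *v ((A *v (L *v x)) ^ 2 * (A *v (L *v w)))"
proof -
  let ?b = "\<lambda>x. B *v x" and ?a = "\<lambda>x. A *v (L *v x)"
  have "6 *s (?b x ^ 2 * ?b w) = ?b (x + w) ^ 3 + ?b (w - x) ^ 3 - 2 *s ?b w ^ 3"
    unfolding cube_polarization[symmetric]
    by (simp add: matrix_vector_right_distrib matrix_vector_mult_diff_distrib)
  also have "\<dots> = M *v (?a (x + w) ^ 3 + ?a (w - x) ^ 3 - 2 *s ?a w ^ 3)"
    unfolding sim
    by (simp add: matrix_vector_right_distrib matrix_vector_mult_diff_distrib vector_scalar_commute)
  also have "\<dots> = M *v (6 *s (?a x ^ 2 * ?a w))"
    unfolding cube_polarization[symmetric]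
    by (simp add: matrix_vector_right_distrib matrix_vector_mult_diff_distrib)
  finally have "6 *s (?b x ^ 2 * ?b w) = 6 *s (M *v (?a x ^ 2 * ?a w))"
    by (simp add: vector_scalar_commute)
  then show ?thesis
    by (simp add: vec_eq_iff)
qed

lemma condition_C2_cubic_similar:
  fixes A B :: "complex ^ 'n ^ 'n"
  assumes C2: "condition_C2 A" and "cubic_similar A B"
  shows "condition_C2 B"
  unfolding condition_C2_def
proof (intro allI impI)
  fix y z :: "complex ^ 'n"
  assume W: "(y, z, B) \<in> W"
  obtain L where L: "invertible L"
    and sim: "\<And>x. (B *v x) ^ 3 = matrix_inv L *v ((A *v (L *v x)) ^ 3)"
    using assms(2) unfolding cubic_similar_def by blast
  let ?M = "matrix_inv L"
  have L_M: "L ** ?M = mat 1" and M_L: "?M ** L = mat 1"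
    using L by (simp_all add: matrix_inv_inverse)
  note pol = cubic_conjugacy_polarized[OF sim]
  \<comment> \<open>Matrices are compared on an arbitrary vector, which plays the role of
    \<open>w\<close> in \<open>pol\<close>.\<close>
  have jac: "diag_mat ((B *v x) ^ 2) ** B = ?M ** (diag_mat ((A *v (L *v x)) ^ 2) ** A) ** L" for x
    by (simp add: matrix_eq diag_mat_mult_vec pol flip: matrix_vector_mul_assoc)
  have det_eq: "det (mat 1 + diag_mat ((B *v x) ^ 2) ** B)
      = det (mat 1 + diag_mat ((A *v (L *v x)) ^ 2) ** A)" for x
  proof -
    have "mat 1 + diag_mat ((B *v x) ^ 2) ** B
        = ?M ** (mat 1 + diag_mat ((A *v (L *v x)) ^ 2) ** A) ** L"
      unfolding jac
      by (simp add: matrix_eq matrix_vector_mult_add_rdistrib matrix_vector_right_distrib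
          flip: matrix_vector_mul_assoc)
        (simp add: matrix_vector_mul_assoc M_L)
    then show ?thesis
      by (simp add: det_conjugate[OF M_L])
  qed
  define w where "w = - (z ^ 3 + z * (B *v y) ^ 2)"
  have "z + B *v (z ^ 3 + z * (B *v y) ^ 2) = 0"
    using W by (simp add: W_def)
  then have z: "z = B *v w"
    unfolding w_def matrix_vector_mult_uminus by (simp only: eq_neg_iff_add_eq_0)
  define y' w' z' where "y' = L *v y" and "w' = L *v w" and "z' = A *v w'"
  \<comment> \<open>With \<open>z = B *v w\<close> the right side is a pure cube plus a polarized
    term, just what \<open>sim\<close> and \<open>pol\<close> rewrite.\<close>
  have "w = - ((B *v w) ^ 3 + (B *v y) ^ 2 * (B *v w))"
    by (subst w_def) (simp only: z mult.commute)
  also have "\<dots> = - (?M *v (z' ^ 3 + z' * (A *v y') ^ 2))"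
    unfolding sim pol
    by (simp add: z'_def w'_def y'_def matrix_vector_right_distrib mult.commute)
  finally have "w = - (?M *v (z' ^ 3 + z' * (A *v y') ^ 2))" .
  then have "L *v w = L *v (?M *v (- (z' ^ 3 + z' * (A *v y') ^ 2)))"
    by (simp only: matrix_vector_mult_uminus)
  then have w': "w' = - (z' ^ 3 + z' * (A *v y') ^ 2)"
    by (simp add: w'_def matrix_vector_mul_assoc L_M)
  \<comment> \<open>The equation required of \<open>z'\<close> is the image under \<open>A\<close>
    of the one for \<open>w'\<close>.\<close>
  have "z' + A *v (z' ^ 3 + z' * (A *v y') ^ 2) = A *v (w' + (z' ^ 3 + z' * (A *v y') ^ 2))"
    by (simp add: z'_def matrix_vector_right_distrib)
  then have "z' + A *v (z' ^ 3 + z' * (A *v y') ^ 2) = 0"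
    using w' by simp
  moreover have "det (mat 1 + diag_mat ((s *s z' + t *s (A *v y')) ^ 2) ** A) = 1" for s t
  proof -
    have "det (mat 1 + diag_mat ((s *s z + t *s (B *v y)) ^ 2) ** B) = 1"
      using W by (simp add: W_def)
    then show ?thesis
      \<comment> \<open>\<open>B\<close> maps this vector to \<open>s *s z + t *s (B *v y)\<close>,
        and \<open>A\<close> maps its image under \<open>L\<close> to
        \<open>s *s z' + t *s (A *v y')\<close>.\<close>
      using det_eq[of "s *s w + t *s y"]
      by (simp add: z z'_def w'_def y'_def matrix_vector_right_distrib vector_scalar_commute)
  qed
  ultimately have "(y', z', A) \<in> W"
    by (simp add: W_def)
  then have "z' = 0"
    using C2 unfolding condition_C2_def by blast
  \<comment> \<open>Both summands in the formula for \<open>w'\<close> contain the factor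
    \<open>z'\<close>.\<close>
  then have "L *v w = 0"
    using w' by (simp add: w'_def)
  then have "w = 0"
    by (metis M_L matrix_vector_mul_assoc matrix_vector_mul_lid matrix_vector_mult_0_right)
  then show "z = 0"
    by (simp add: z)
qed

theorem theorem1p7:
  fixes A :: "complex ^ 'n ^ 'n"
  shows "condition_C2 A \<longleftrightarrow> (\<forall>B :: complex ^ 'n ^ 'n. cubic_similar A B \<longrightarrow> condition_C2 B)"
  using condition_C2_cubic_similar cubic_similar_refl by blast

end
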